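(* The graph $\mathcal Y$ defined in the context is $K_4$-UH, i.e. every isomorphism between two induced subgraphs of $\mathcal Y$ isomorphic to $K_4$ extends to an automorphism of $\mathcal Y$.
   Context: The Biggs-Smith graph $\mathcal S$ is the cubic graph on the $102$ vertices $A_i,B_i,C_i,D_i,E_i,F_i$ ($i\in\mathbb Z_{17}$) whose edges are, for every $i\in\mathbb Z_{17}$: $A_iA_{i+1}$, $D_iD_{i+2}$, $C_iC_{i+4}$, $F_iF_{i+8}$, $A_iB_i$, $B_iC_i$, $D_iE_i$, $E_iF_i$, $B_iE_i$ (indices mod $17$). The graph $\mathcal Y$ has vertex set $V(\mathcal S)$, and two distinct vertices $u,v$ are adjacent in $\mathcal Y$ iff there is a $9$-cycle $(v_0,v_1,\dots,v_8)$ of $\mathcal S$ and an index $i$ with $\{u,v\}=\{v_i,v_{i+3}\}$ (indices mod $9$). *)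

theory Defs
  imports "Graph_Theory.Graph_Theory" "HOL-Library.Numeral_Type"
begin

text \<open>
  As in the underlying graph library, an undirected simple graph is a symmetric loopless digraph
  whose arcs are pairs of vertices: the edge \<open>{u, v}\<close> is the pair of arcs \<open>(u, v)\<close>, \<open>(v, u)\<close>.
  Indices range over the type \<open>17\<close>, whose addition is addition modulo 17.
\<close>

datatype bs_vertex =
  A_vert 17 | B_vert 17 | C_vert 17 | D_vert 17 | E_vert 17 | F_vert 17

definition bs_edges :: "bs_vertex rel" where
  "bs_edges = (\<Union>i. {
     (A_vert i, A_vert (i + 1)), (D_vert i, D_vert (i + 2)),
     (C_vert i, C_vert (i + 4)), (F_vert i, F_vert (i + 8)),
     (A_vert i, B_vert i), (B_vert i, C_vert i),
     (D_vert i, E_vert i), (E_vert i, F_vert i), (B_vert i, E_vert i)})"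

definition biggs_smith :: "bs_vertex pair_pre_digraph" where
  "biggs_smith = \<lparr> pverts = UNIV, parcs = bs_edges \<union> bs_edges\<inverse> \<rparr>"

text \<open>
  A 9-cycle \<open>(v\<^sub>0, \<dots>, v\<^sub>8)\<close> is given by its list of arcs \<open>p\<close>, where \<open>p ! i\<close> is the arc from
  \<open>v\<^sub>i\<close> to \<open>v\<^sub>i\<^sub>+\<^sub>1\<close>; hence \<open>v\<^sub>i = fst (p ! i)\<close>.
\<close>

definition graph_Y :: "bs_vertex pair_pre_digraph" where
  "graph_Y = \<lparr> pverts = pverts biggs_smith,
     parcs = {(u, v). u \<noteq> v \<and>
       (\<exists>p. pre_digraph.cycle (with_proj biggs_smith) p \<and> length p = 9 \<and>
         (\<exists>i<9. {u, v} = {fst (p ! i), fst (p ! ((i + 3) mod 9))}))} \<rparr>"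

definition is_isomorphism ::
    "('a, 'b) pre_digraph \<Rightarrow> ('c, 'd) pre_digraph \<Rightarrow> ('a, 'b, 'c, 'd) digraph_isomorphism \<Rightarrow> bool"
  where "is_isomorphism G H f \<longleftrightarrow> pre_digraph.digraph_isomorphism G f \<and> H = app_iso f G"

definition ultrahomogeneous ::
    "(('a, 'b) pre_digraph \<Rightarrow> bool) \<Rightarrow> ('a, 'b) pre_digraph \<Rightarrow> bool"
  where "ultrahomogeneous \<C> G \<longleftrightarrow>
    (\<forall>H\<^sub>1 H\<^sub>2 f. induced_subgraph H\<^sub>1 G \<and> induced_subgraph H\<^sub>2 G \<and> \<C> H\<^sub>1 \<and> \<C> H\<^sub>2 \<and>
        is_isomorphism H\<^sub>1 H\<^sub>2 f \<longrightarrow>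
      (\<exists>g. is_isomorphism G G g \<and>
        (\<forall>v\<in>verts H\<^sub>1. iso_verts g v = iso_verts f v) \<and>
        (\<forall>a\<in>arcs H\<^sub>1. iso_arcs g a = iso_arcs f a)))"

lemma UNIV_bs_vertex:
  "(UNIV :: bs_vertex set) = range A_vert \<union> range B_vert \<union> range C_vert \<union>
     range D_vert \<union> range E_vert \<union> range F_vert"
proof -
  have "v \<in> range A_vert \<union> range B_vert \<union> range C_vert \<union>
     range D_vert \<union> range E_vert \<union> range F_vert" for v
    by (cases v) auto
  then show ?thesis by blast
qed

instance bs_vertex :: finite
  by standard (simp add: UNIV_bs_vertex)

lemma card_bs_vertex: "CARD(bs_vertex) = 102"
  unfolding UNIV_bs_vertex
  by (subst card_Un_disjoint | force simp: card_image inj_on_def)+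

lemma pair_graph_biggs_smith: "pair_graph biggs_smith"
  by unfold_locales (auto simp: biggs_smith_def bs_edges_def symmetric_def sym_def)

lemma pair_graph_Y: "pair_graph graph_Y"
  by unfold_locales
    (auto simp: graph_Y_def biggs_smith_def symmetric_def sym_def insert_commute)

end

theory Submission
  imports Defs
begin

text \<open>
  Let \<open>u\<close>, \<open>v\<close> be related if some non-backtracking walk with three steps of the Biggs-Smith graph
  joins them. Vertices at distance 3 on a 9-cycle are related, so every 4-clique of \<open>\<Y>\<close> is a clique
  of this relation, and automorphisms of the Biggs-Smith graph act on \<open>\<Y>\<close>. They act transitively
  on the ordered 4-cliques of the relation: they are transitive on vertices, the stabilizer of
  \<open>A\<^sub>0\<close> is transitive on the 12 vertices related to \<open>A\<^sub>0\<close>, the only two vertices related to each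
  other and to both \<open>A\<^sub>0\<close> and \<open>A\<^sub>3\<close> are \<open>C\<^sub>4\<close> and \<open>C\<^sub>1\<^sub>6\<close>, and some automorphism fixes \<open>A\<^sub>0\<close> and
  \<open>A\<^sub>3\<close> and swaps these two. Hence an isomorphism between two 4-cliques is the restriction of
  \<open>\<psi>\<^sup>-\<^sup>1 \<circ> \<phi>\<close>, where \<open>\<phi>\<close> and \<open>\<psi>\<close> bring source and target into the same standard position.
\<close>

section \<open>Arithmetic modulo 17 and adjacency by neighbour lists\<close>

lemma normalize_17:
  "(17::17) = 0"
  "(18::17) = 1"
  "(19::17) = 2"
  "(20::17) = 3"
  "(21::17) = 4"
  "(22::17) = 5"
  "(23::17) = 6"
  "(24::17) = 7"
  "(25::17) = 8"
  "(26::17) = 9"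
  "(27::17) = 10"
  "(28::17) = 11"
  "(29::17) = 12"
  "(30::17) = 13"
  "(31::17) = 14"
  "(32::17) = 15"
  "(- 1::17) = 16"
  "(- 2::17) = 15"
  "(- 3::17) = 14"
  "(- 4::17) = 13"
  "(- 5::17) = 12"
  "(- 6::17) = 11"
  "(- 7::17) = 10"
  "(- 8::17) = 9"
  "(- 9::17) = 8"
  "(- 10::17) = 7"
  "(- 11::17) = 6"
  "(- 12::17) = 5"
  "(- 13::17) = 4"
  "(- 14::17) = 3"
  "(- 15::17) = 2"
  "(- 16::17) = 1"
  by simp_all

text \<open>
  Differences \<open>i - k\<close> are written \<open>i + (17 - k)\<close>, so that evaluation only meets numerals between
  0 and 32.
\<close>

primrec nbrs :: "bs_vertex \<Rightarrow> bs_vertex list" where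
  "nbrs (A_vert i) = [A_vert (i + 1), A_vert (i + 16), B_vert i]"
| "nbrs (B_vert i) = [A_vert i, C_vert i, E_vert i]"
| "nbrs (C_vert i) = [C_vert (i + 4), C_vert (i + 13), B_vert i]"
| "nbrs (D_vert i) = [D_vert (i + 2), D_vert (i + 15), E_vert i]"
| "nbrs (E_vert i) = [B_vert i, D_vert i, F_vert i]"
| "nbrs (F_vert i) = [F_vert (i + 8), F_vert (i + 9), E_vert i]"

lemma in_parcs_biggs_smith_iff: "(u, v) \<in> parcs biggs_smith \<longleftrightarrow> v \<in> set (nbrs u)"
proof -
  have "i = j + 1 \<longleftrightarrow> j = i + 16" "i = j + 2 \<longleftrightarrow> j = i + 15"
    "i = j + 4 \<longleftrightarrow> j = i + 13" "i = j + 8 \<longleftrightarrow> j = i + 9" for i j :: 17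
    by (auto simp: normalize_17)
  then show ?thesis
    by (cases u; cases v) (auto simp: biggs_smith_def bs_edges_def)
qed

lemma all_bs_vertex_iff:
  "(\<forall>v. P v) \<longleftrightarrow> (\<forall>i. P (A_vert i)) \<and> (\<forall>i. P (B_vert i)) \<and> (\<forall>i. P (C_vert i)) \<and>
     (\<forall>i. P (D_vert i)) \<and> (\<forall>i. P (E_vert i)) \<and> (\<forall>i. P (F_vert i))"
  by (metis bs_vertex.exhaust)

section \<open>Non-backtracking 3-step walks and automorphisms of the Biggs-Smith graph\<close>

text \<open>This relation stands in for adjacency in \<open>graph_Y\<close>: it can be evaluated by
  expanding neighbour lists three times, with no enumeration of 9-cycles.\<close>

definition three_arc :: "bs_vertex \<Rightarrow> bs_vertex \<Rightarrow> bool" where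
  "three_arc u v \<longleftrightarrow> (\<exists>a b. (u, a) \<in> parcs biggs_smith \<and> (a, b) \<in> parcs biggs_smith \<and>
     (b, v) \<in> parcs biggs_smith \<and> b \<noteq> u \<and> v \<noteq> a)"

definition three_arc_ends :: "bs_vertex \<Rightarrow> bs_vertex list" where
  "three_arc_ends u = [v. a \<leftarrow> nbrs u, b \<leftarrow> nbrs a, b \<noteq> u, v \<leftarrow> nbrs b, v \<noteq> a]"

lemma three_arc_iff: "three_arc u v \<longleftrightarrow> v \<in> set (three_arc_ends u)"
  by (auto simp: three_arc_def three_arc_ends_def in_parcs_biggs_smith_iff)

definition bs_aut :: "(bs_vertex \<Rightarrow> bs_vertex) \<Rightarrow> bool" where
  "bs_aut \<phi> \<longleftrightarrow> bij \<phi> \<and>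
     (\<forall>u v. (\<phi> u, \<phi> v) \<in> parcs biggs_smith \<longleftrightarrow> (u, v) \<in> parcs biggs_smith)"

text \<open>The arc set is finite, so an injective map that sends arcs to arcs permutes the arcs;
  hence non-arcs go to non-arcs. Bijectivity on vertices follows from finiteness in the same
  way.\<close>

lemma bs_autI:
  assumes "inj \<phi>" and "\<And>u v. v \<in> set (nbrs u) \<Longrightarrow> \<phi> v \<in> set (nbrs (\<phi> u))"
  shows "bs_aut \<phi>"
proof -
  let ?E = "parcs biggs_smith"
  have inj: "inj (map_prod \<phi> \<phi>)"
    using assms(1) by (rule prod.inj_map[OF _ assms(1)])
  have "map_prod \<phi> \<phi> ` ?E = ?E"
    using assms(2) inj_on_subset[OF inj]
    by (intro endo_inj_surj) (auto simp: in_parcs_biggs_smith_iff)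
  then have "(\<phi> u, \<phi> v) \<in> ?E \<longleftrightarrow> (u, v) \<in> ?E" for u v
    using inj_image_mem_iff[OF inj, of "(u, v)" ?E] by simp
  moreover have "bij \<phi>"
    using assms(1) by (simp add: bij_def finite_UNIV_inj_surj)
  ultimately show ?thesis by (simp add: bs_aut_def)
qed

lemma bs_aut_id: "bs_aut id"
  by (simp add: bs_aut_def)

lemma bs_aut_comp: "bs_aut \<phi> \<Longrightarrow> bs_aut \<psi> \<Longrightarrow> bs_aut (\<phi> \<circ> \<psi>)"
  by (auto simp: bs_aut_def intro: bij_comp)

lemma bs_aut_funpow: "bs_aut \<phi> \<Longrightarrow> bs_aut (\<phi> ^^ n)"
  by (induction n) (simp_all only: funpow.simps bs_aut_id bs_aut_comp)

lemma bs_aut_inv: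
  assumes "bs_aut \<phi>"
  shows "bs_aut (inv \<phi>)"
proof -
  have "bij \<phi>"
    and iff: "(\<phi> u, \<phi> v) \<in> parcs biggs_smith \<longleftrightarrow> (u, v) \<in> parcs biggs_smith" for u v
    using assms by (auto simp: bs_aut_def)
  then have "\<phi> (inv \<phi> v) = v" for v
    by (simp add: bij_is_surj surj_f_inv_f)
  then have "(inv \<phi> u, inv \<phi> v) \<in> parcs biggs_smith \<longleftrightarrow> (u, v) \<in> parcs biggs_smith" for u v
    using iff[of "inv \<phi> u" "inv \<phi> v"] by simp
  then show ?thesis
    using \<open>bij \<phi>\<close> by (simp add: bs_aut_def bij_imp_bij_inv)
qed

lemma three_arc_aut:
  assumes "bs_aut \<phi>" and "three_arc u v"
  shows "three_arc (\<phi> u) (\<phi> v)"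
proof -
  obtain a b where "(u, a) \<in> parcs biggs_smith" "(a, b) \<in> parcs biggs_smith"
    "(b, v) \<in> parcs biggs_smith" "b \<noteq> u" "v \<noteq> a"
    using assms(2) by (auto simp: three_arc_def)
  moreover have "inj \<phi>"
    using assms(1) by (simp add: bs_aut_def bij_is_inj)
  ultimately show ?thesis
    using assms(1) unfolding three_arc_def bs_aut_def
    by (intro exI[of _ "\<phi> a"] exI[of _ "\<phi> b"]) (simp add: inj_eq)
qed

section \<open>Explicit automorphisms: rotation, doubling, reflection and a rotation about a
  vertex\<close>

primrec shift :: "bs_vertex \<Rightarrow> bs_vertex" where
  "shift (A_vert i) = A_vert (i + 1)"
| "shift (B_vert i) = B_vert (i + 1)"
| "shift (C_vert i) = C_vert (i + 1)"
| "shift (D_vert i) = D_vert (i + 1)"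
| "shift (E_vert i) = E_vert (i + 1)"
| "shift (F_vert i) = F_vert (i + 1)"

text \<open>Doubling an index turns the step lengths 1, 2, 4, 8 into 2, 4, 8, 16, and 16 is -1
  modulo 17. So the letters with these steps move in the cycle A, D, C, F, which forces B and E to
  be swapped.\<close>

primrec doubling :: "bs_vertex \<Rightarrow> bs_vertex" where
  "doubling (A_vert i) = D_vert (2 * i)"
| "doubling (B_vert i) = E_vert (2 * i)"
| "doubling (C_vert i) = F_vert (2 * i)"
| "doubling (D_vert i) = C_vert (2 * i)"
| "doubling (E_vert i) = B_vert (2 * i)"
| "doubling (F_vert i) = A_vert (2 * i)"

text \<open>The representative between 0 and 16, used as a position in the tables of
  \<open>turn\<close>.\<close>

definition pos :: "17 \<Rightarrow> nat" where
  "pos i = nat (Rep_bit1 i)"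

text \<open>
  An automorphism of order 3 that fixes \<open>A\<^sub>0\<close> and permutes its neighbours cyclically, found by
  computer search. The maps \<open>shift\<close> and \<open>doubling\<close> preserve \<open>{A, C, D, F}\<close> and \<open>{B, E}\<close>; this one
  does not.
\<close>

primrec turn :: "bs_vertex \<Rightarrow> bs_vertex" where
  "turn (A_vert i) =
     [A_vert 0, B_vert 0, C_vert 0, C_vert 4, C_vert 8, B_vert 8, A_vert 8, A_vert 7,
      B_vert 7, E_vert 7, D_vert 7, D_vert 5, D_vert 3, D_vert 1, E_vert 1, B_vert 1, A_vert 1] ! pos i"
| "turn (B_vert i) =
     [A_vert 16, E_vert 0, C_vert 13, B_vert 4, C_vert 12, E_vert 8, A_vert 9, A_vert 6,
      C_vert 7, F_vert 7, D_vert 9, E_vert 5, E_vert 3, D_vert 16, F_vert 1, C_vert 1,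
      A_vert 2] ! pos i"
| "turn (C_vert i) =
     [B_vert 16, F_vert 0, C_vert 9, A_vert 4, C_vert 16, F_vert 8, B_vert 9, A_vert 5,
      C_vert 3, F_vert 16, E_vert 9, B_vert 5, B_vert 3, E_vert 16, F_vert 9, C_vert 5,
      A_vert 3] ! pos i"
| "turn (D_vert i) =
     [A_vert 14, D_vert 2, A_vert 13, D_vert 4, A_vert 12, D_vert 6, A_vert 11, E_vert 6,
      B_vert 11, F_vert 6, E_vert 11, F_vert 14, F_vert 11, E_vert 14, F_vert 2, B_vert 14,
      E_vert 2] ! pos i"
| "turn (E_vert i) =
     [A_vert 15, D_vert 0, B_vert 13, E_vert 4, B_vert 12, D_vert 8, A_vert 10, B_vert 6,
      C_vert 11, F_vert 15, D_vert 11, F_vert 5, F_vert 3, D_vert 14, F_vert 10, C_vert 14,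
      B_vert 2] ! pos i"
| "turn (F_vert i) =
     [B_vert 15, D_vert 15, E_vert 13, F_vert 4, E_vert 12, D_vert 10, B_vert 10, C_vert 6,
      C_vert 15, E_vert 15, D_vert 13, F_vert 13, F_vert 12, D_vert 12, E_vert 10, C_vert 10,
      C_vert 2] ! pos i"

lemma pos_simps [simp]:
  "pos 0 = 0"
  "pos 1 = 1"
  "pos 2 = 2"
  "pos 3 = 3"
  "pos 4 = 4"
  "pos 5 = 5"
  "pos 6 = 6"
  "pos 7 = 7"
  "pos 8 = 8"
  "pos 9 = 9"
  "pos 10 = 10"
  "pos 11 = 11"
  "pos 12 = 12"
  "pos 13 = 13"
  "pos 14 = 14"
  "pos 15 = 15"
  "pos 16 = 16"
  by (simp_all add: pos_def bit1.Rep_numeral bit1.Rep_0 bit1.Rep_1)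

lemma UNIV_17: "(UNIV :: 17 set) = {0, 1, 2, 3, 4, 5, 6, 7, 8, 9, 10, 11, 12, 13, 14, 15, 16}"
proof -
  have "i \<in> of_int ` {0..16}" for i :: 17
    by (cases i) auto
  then have "(UNIV :: 17 set) = of_int ` set [0..16]"
    by auto
  also have "set [0..16] = {0, 1, 2, 3, 4, 5, 6, 7, 8, 9, 10, 11, 12, 13, 14, 15, 16::int}"
    by (simp add: upto_rec1)
  finally show ?thesis
    by (simp only: image_insert image_empty of_int_0 of_int_1 of_int_numeral)
qed

lemma all_17_iff:
  "(\<forall>i::17. P i) \<longleftrightarrow>
     P 0 \<and> P 1 \<and> P 2 \<and> P 3 \<and> P 4 \<and> P 5 \<and> P 6 \<and> P 7 \<and> P
     8 \<and> P 9 \<and> P 10 \<and> P 11 \<and> P 12 \<and> P 13 \<and> P 14 \<and> P 15 \<and> P 16"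
proof -
  have "(\<forall>i. P i) \<longleftrightarrow> (\<forall>i\<in>UNIV. P i)"
    by simp
  then show ?thesis
    by (simp only: UNIV_17 ball_simps simp_thms)
qed

lemma bs_aut_shift: "bs_aut shift"
proof (rule bs_autI)
  show "inj shift"
  proof (rule injI)
    show "u = v" if "shift u = shift v" for u v
      using that by (cases u; cases v) simp_all
  qed
  show "shift v \<in> set (nbrs (shift u))" if "v \<in> set (nbrs u)" for u v
    using that by (cases u) (auto simp: algebra_simps)
qed

lemma double_eq_iff_17: "2 * i = 2 * j \<longleftrightarrow> i = j" for i j :: 17
proof
  \<comment> \<open>9 is the inverse of 2 modulo 17, since 9 * 2 = 18.\<close>
  have "9 * (2 * i) = i" for i :: 17
    by (simp add: normalize_17 flip: mult.assoc)
  then show "i = j" if "2 * i = 2 * j"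
    using that by metis
qed simp

lemma bs_aut_doubling: "bs_aut doubling"
proof (rule bs_autI)
  show "inj doubling"
  proof (rule injI)
    show "u = v" if "doubling u = doubling v" for u v
      using that by (cases u; cases v) (simp_all add: double_eq_iff_17)
  qed
  show "doubling v \<in> set (nbrs (doubling u))" if "v \<in> set (nbrs u)" for u v
    using that by (cases u) (auto simp: algebra_simps normalize_17)
qed

text \<open>A check of all 102 vertices. Injectivity comes from the third power being the identity;
  adjacency is tested on each neighbour list.\<close>

lemma bs_aut_turn: "bs_aut turn"
proof (rule bs_autI)
  have "\<forall>v. turn (turn (turn v)) = v"
    unfolding all_bs_vertex_iff all_17_iff by simp
  then show "inj turn"
    by (metis injI)
  have "\<forall>v. list_all (\<lambda>w. turn w \<in> set (nbrs (turn v))) (nbrs v)"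
    unfolding all_bs_vertex_iff all_17_iff by (simp add: normalize_17)
  then show "turn v \<in> set (nbrs (turn u))" if "v \<in> set (nbrs u)" for u v
    using that by (auto simp: list_all_iff)
qed

definition reflection :: "bs_vertex \<Rightarrow> bs_vertex" where
  "reflection = doubling ^^ 4"

lemma bs_aut_reflection: "bs_aut reflection"
  by (simp add: reflection_def bs_aut_funpow bs_aut_doubling)

text \<open>Four doublings bring every letter back to itself and multiply the index by 16, which is
  -1 modulo 17.\<close>

lemma reflection_simps [simp]:
  "reflection (A_vert i) = A_vert (- i)"
  "reflection (B_vert i) = B_vert (- i)"
  "reflection (C_vert i) = C_vert (- i)"
  "reflection (D_vert i) = D_vert (- i)"
  "reflection (E_vert i) = E_vert (- i)"
  "reflection (F_vert i) = F_vert (- i)"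
  by (simp_all add: reflection_def eval_nat_numeral normalize_17)


section \<open>Transitivity on ordered 4-cliques of the relation\<close>

lemma bs_aut_foldr: "(\<And>\<phi>. \<phi> \<in> set \<phi>s \<Longrightarrow> bs_aut \<phi>) \<Longrightarrow> bs_aut (foldr (\<circ>) \<phi>s id)"
  by (induction \<phi>s) (simp_all only: foldr.simps bs_aut_id bs_aut_comp list.set_intros id_apply o_apply)

lemma shift_funpow:
  "(shift ^^ n) (A_vert i) = A_vert (i + of_nat n)"
  "(shift ^^ n) (B_vert i) = B_vert (i + of_nat n)"
  by (induction n) (simp_all add: ac_simps)

lemma of_nat_surj_17: "\<exists>n. of_nat n = i" for i :: 17
proof (cases i)
  case (of_int z)
  then have "of_nat (nat z) = i"
    by (simp only: of_nat_nat)
  then show ?thesis ..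
qed

text \<open>Rotation and doubling merge the letters A, C, D, F into one orbit and B, E into another;
  \<open>turn\<close> joins the two because it sends \<open>B_vert 0\<close> to
  \<open>A_vert 16\<close>.\<close>

lemma bs_vertex_transitive: "\<exists>\<phi>. bs_aut \<phi> \<and> \<phi> v = A_vert 0"
proof -
  have step: "\<exists>\<phi>. bs_aut \<phi> \<and> \<phi> w = A_vert 0"
    if "bs_aut \<psi>" "\<exists>\<phi>. bs_aut \<phi> \<and> \<phi> (\<psi> w) = A_vert 0" for \<psi> w
    using that by (metis bs_aut_comp comp_apply)
  have A: "\<exists>\<phi>. bs_aut \<phi> \<and> \<phi> (A_vert i) = A_vert 0" for i
  proof -
    obtain n where "of_nat n = - i"
      using of_nat_surj_17 by blast
    then have "(shift ^^ n) (A_vert i) = A_vert 0"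
      by (simp add: shift_funpow)
    then show ?thesis
      using bs_aut_funpow[OF bs_aut_shift] by blast
  qed
  have F: "\<exists>\<phi>. bs_aut \<phi> \<and> \<phi> (F_vert i) = A_vert 0" for i
    by (rule step[OF bs_aut_doubling]) (simp add: A)
  have C: "\<exists>\<phi>. bs_aut \<phi> \<and> \<phi> (C_vert i) = A_vert 0" for i
    by (rule step[OF bs_aut_doubling]) (simp add: F)
  have D: "\<exists>\<phi>. bs_aut \<phi> \<and> \<phi> (D_vert i) = A_vert 0" for i
    by (rule step[OF bs_aut_doubling]) (simp add: C)
  have B: "\<exists>\<phi>. bs_aut \<phi> \<and> \<phi> (B_vert i) = A_vert 0" for i
  proof -
    obtain n where "of_nat n = - i"
      using of_nat_surj_17 by blast
    then have "turn ((shift ^^ n) (B_vert i)) = A_vert 16"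
      by (simp add: shift_funpow)
    then show ?thesis
      using step[OF bs_aut_funpow[OF bs_aut_shift], of n] step[OF bs_aut_turn] A by metis
  qed
  have E: "\<exists>\<phi>. bs_aut \<phi> \<and> \<phi> (E_vert i) = A_vert 0" for i
    by (rule step[OF bs_aut_doubling]) (simp add: B)
  show ?thesis
    using A B C D E F by (cases v) simp_all
qed

lemma three_arc_ends_A0:
  "three_arc_ends (A_vert 0) =
     [A_vert 3, B_vert 2, C_vert 1, E_vert 1, A_vert 14, B_vert 15, C_vert 16, E_vert 16,
      C_vert 4, C_vert 13, D_vert 0, F_vert 0]"
  by (simp add: three_arc_ends_def normalize_17)

lemma three_arc_ends_A3:
  "three_arc_ends (A_vert 3) =
     [A_vert 6, B_vert 5, C_vert 4, E_vert 4, A_vert 0, B_vert 1, C_vert 2, E_vert 2,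
      C_vert 7, C_vert 16, D_vert 3, F_vert 3]"
  by (simp add: three_arc_ends_def normalize_17)

lemma three_arc_transitive_at_A0:
  assumes "three_arc (A_vert 0) b"
  shows "\<exists>\<phi>. bs_aut \<phi> \<and> \<phi> (A_vert 0) = A_vert 0 \<and> \<phi> b = A_vert 3"
proof -
  let ?n = reflection and ?h = turn
  \<comment> \<open>One word for each of the twelve ends of \<open>A_vert 0\<close>, bringing it to
    \<open>A_vert 3\<close>; the rightmost letter acts first. Both letters fix
    \<open>A_vert 0\<close>, hence so does every word.\<close>
  let ?words = "[[], [?n], [?h], [?h, ?n], [?n, ?h], [?h, ?h], [?h, ?h, ?n], [?h, ?n, ?h],
    [?n, ?h, ?h], [?h, ?n, ?h, ?n], [?n, ?h, ?h, ?n], [?h, ?n, ?h, ?h]]"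
  have "\<exists>w\<in>set ?words. foldr (\<circ>) w id b = A_vert 3"
    using assms by (auto simp: three_arc_iff three_arc_ends_A0 normalize_17)
  then obtain w where w: "w \<in> set ?words" "foldr (\<circ>) w id b = A_vert 3"
    by blast
  have gens: "set w \<subseteq> {?n, ?h}"
    using w(1) by auto
  then have "bs_aut (foldr (\<circ>) w id)"
    using bs_aut_reflection bs_aut_turn by (intro bs_aut_foldr) auto
  moreover have "foldr (\<circ>) w id (A_vert 0) = A_vert 0"
    using gens by (induction w) auto
  ultimately show ?thesis
    using w(2) by blast
qed

lemma swap_at_A0_A3:
  "\<exists>\<phi>. bs_aut \<phi> \<and> \<phi> (A_vert 0) = A_vert 0 \<and> \<phi> (A_vert 3) = A_vert 3 \<and>
     \<phi> (C_vert 4) = C_vert 16 \<and> \<phi> (C_vert 16) = C_vert 4"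
proof -
  \<comment> \<open>Since \<open>turn\<close> has order 3, this is \<open>reflection\<close>
    conjugated by \<open>reflection \<circ> turn\<close>. The reflection fixes
    \<open>A_vert 0\<close> and \<open>D_vert 0\<close>, which the conjugating map sends to
    \<open>A_vert 0\<close> and \<open>A_vert 3\<close>.\<close>
  let ?w = "[reflection, turn, reflection, turn, turn, reflection]"
  have "bs_aut (foldr (\<circ>) ?w id)"
    using bs_aut_reflection bs_aut_turn by (intro bs_aut_foldr) auto
  moreover have "foldr (\<circ>) ?w id (A_vert 0) = A_vert 0" "foldr (\<circ>) ?w id (A_vert 3) = A_vert 3"
    "foldr (\<circ>) ?w id (C_vert 4) = C_vert 16" "foldr (\<circ>) ?w id (C_vert 16) = C_vert 4"
    by (simp_all add: normalize_17)
  ultimately show ?thesis by blast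
qed

lemma common_three_arc_ends:
  assumes "three_arc (A_vert 0) c" "three_arc (A_vert 0) d" "three_arc (A_vert 3) c"
    "three_arc (A_vert 3) d" "three_arc c d"
  shows "c = C_vert 4 \<and> d = C_vert 16 \<or> c = C_vert 16 \<and> d = C_vert 4"
proof -
  have "v \<in> {C_vert 4, C_vert 16}" if "three_arc (A_vert 0) v" "three_arc (A_vert 3) v" for v
    using that by (auto simp: three_arc_iff three_arc_ends_A0 three_arc_ends_A3)
  then have "c \<in> {C_vert 4, C_vert 16}" "d \<in> {C_vert 4, C_vert 16}"
    using assms by blast+
  \<comment> \<open>Neither candidate occurs in its own list of ends, so \<open>c\<close> and
    \<open>d\<close> differ.\<close>
  with assms(5) show ?thesis
    by (auto simp: three_arc_iff three_arc_ends_def normalize_17)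
qed

lemma three_arc_clique_transitive:
  assumes "three_arc a b" "three_arc a c" "three_arc a d" "three_arc b c" "three_arc b d"
    "three_arc c d"
  shows "\<exists>\<phi>. bs_aut \<phi> \<and> map \<phi> [a, b, c, d] = [A_vert 0, A_vert 3, C_vert 4, C_vert 16]"
proof -
  obtain \<phi>\<^sub>1 where 1: "bs_aut \<phi>\<^sub>1" "\<phi>\<^sub>1 a = A_vert 0"
    using bs_vertex_transitive by blast
  obtain \<phi>\<^sub>2 where 2: "bs_aut \<phi>\<^sub>2" "\<phi>\<^sub>2 (A_vert 0) = A_vert 0" "\<phi>\<^sub>2 (\<phi>\<^sub>1 b) = A_vert 3"
    using three_arc_transitive_at_A0[of "\<phi>\<^sub>1 b"] three_arc_aut[OF 1(1) assms(1)] 1(2) by auto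
  define \<psi> where "\<psi> = \<phi>\<^sub>2 \<circ> \<phi>\<^sub>1"
  have \<psi>: "bs_aut \<psi>" "\<psi> a = A_vert 0" "\<psi> b = A_vert 3"
    using 1 2 by (simp_all add: \<psi>_def bs_aut_comp)
  have "\<psi> c = C_vert 4 \<and> \<psi> d = C_vert 16 \<or> \<psi> c = C_vert 16 \<and> \<psi> d = C_vert 4"
    using assms(2-6)[THEN three_arc_aut[OF \<psi>(1)]] unfolding \<psi>(2,3)
    by (intro common_three_arc_ends)
  then show ?thesis
  proof
    assume "\<psi> c = C_vert 4 \<and> \<psi> d = C_vert 16"
    with \<psi> show ?thesis by auto
  next
    assume *: "\<psi> c = C_vert 16 \<and> \<psi> d = C_vert 4"
    obtain \<sigma> where \<sigma>: "bs_aut \<sigma>" "\<sigma> (A_vert 0) = A_vert 0" "\<sigma> (A_vert 3) = A_vert 3"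
      "\<sigma> (C_vert 4) = C_vert 16" "\<sigma> (C_vert 16) = C_vert 4"
      using swap_at_A0_A3 by blast
    have "map (\<sigma> \<circ> \<psi>) [a, b, c, d] = [A_vert 0, A_vert 3, C_vert 4, C_vert 16]"
      using \<psi> \<sigma> * by simp
    with bs_aut_comp[OF \<sigma>(1) \<psi>(1)] show ?thesis
      by (intro exI[of _ "\<sigma> \<circ> \<psi>"] conjI)
  qed
qed

section \<open>From 9-cycles to the relation, and the action on \<open>graph_Y\<close>\<close>

lemma parcs_biggs_smith_sym: "(u, v) \<in> parcs biggs_smith \<Longrightarrow> (v, u) \<in> parcs biggs_smith"
  by (auto simp: biggs_smith_def)

lemma three_arc_sym: "three_arc u v \<Longrightarrow> three_arc v u"
  unfolding three_arc_def by (blast intro: parcs_biggs_smith_sym)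

text \<open>With this form, the library's condition that a cycle repeats no vertex after its start
  becomes distinctness of the heads of its arcs.\<close>

lemma pawalk_verts_conv: "pcas u p v \<Longrightarrow> pawalk_verts u p = u # map snd p"
  by (induction p arbitrary: u) auto

lemma pcas_nth:
  "pcas u p v \<Longrightarrow> i < length p \<Longrightarrow> snd (p ! i) = (if Suc i < length p then fst (p ! Suc i) else v)"
proof (induction p arbitrary: u i)
  case (Cons e p)
  then show ?case by (cases i; cases p) auto
qed simp

text \<open>Three consecutive arcs of the cycle form a walk, and it does not backtrack because
  vertices two places apart on the cycle are distinct.\<close>

lemma three_arc_of_9_cycle:
  assumes "pre_digraph.cycle (with_proj biggs_smith) p" "length p = 9"
  shows "three_arc (fst (p ! (i mod 9))) (fst (p ! ((i + 3) mod 9)))"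
proof -
  obtain u where p: "set p \<subseteq> parcs biggs_smith" "pcas u p u" "distinct (map snd p)"
    using assms(1)
    by (auto simp: pre_digraph.cycle_def pre_digraph.awalk_def cas_with_proj_eq
        awalk_verts_with_proj_eq pawalk_verts_conv)
  \<comment> \<open>Reducing indices modulo 9 lets the closing arc be treated like all
    others.\<close>
  define x where "x j = fst (p ! (j mod 9))" for j
  have fst_0: "fst (p ! 0) = u"
    using p(2) assms(2) by (cases p) auto
  have snd_nth: "snd (p ! (j mod 9)) = x (Suc j)" for j
  proof -
    have "snd (p ! (j mod 9)) = (if Suc (j mod 9) < 9 then fst (p ! Suc (j mod 9)) else u)"
      using pcas_nth[OF p(2), of "j mod 9"] assms(2) by simp
    then show ?thesis
      using fst_0 by (auto simp: x_def mod_Suc split: if_splits)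
  qed
  have arc: "(x j, x (Suc j)) \<in> parcs biggs_smith" for j
    using p(1) assms(2) nth_mem[of "j mod 9" p] snd_nth[of j]
    by (metis mod_less_divisor prod.collapse subsetD x_def zero_less_numeral)
  have neq: "x (Suc (Suc j)) \<noteq> x j" for j
  proof -
    \<comment> \<open>Modulo 9 these are the positions \<open>j - 1\<close> and \<open>j + 1\<close>
      of the arcs whose heads are \<open>x j\<close> and \<open>x (j + 2)\<close>; heads at
      different positions differ.\<close>
    have "(j + 8) mod 9 \<noteq> (j + 10) mod 9"
      using mod_eq_dvd_iff_nat[of "j + 8" "j + 10" 9] by auto
    then have "snd (p ! ((j + 8) mod 9)) \<noteq> snd (p ! ((j + 10) mod 9))"
      using nth_eq_iff_index_eq[OF p(3), of "(j + 8) mod 9" "(j + 10) mod 9"] assms(2) by simp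
    moreover have "Suc (j + 8) = j + 9" "Suc (j + 10) = Suc (Suc j) + 9"
      by simp_all
    then have "Suc (j + 8) mod 9 = j mod 9" "Suc (j + 10) mod 9 = Suc (Suc j) mod 9"
      by (simp_all only: mod_add_self2)
    ultimately show ?thesis
      by (simp only: snd_nth x_def) simp
  qed
  have "three_arc (x i) (x (Suc (Suc (Suc i))))"
    unfolding three_arc_def
    by (intro exI[of _ "x (Suc i)"] exI[of _ "x (Suc (Suc i))"] conjI arc neq)
  moreover have "Suc (Suc (Suc i)) = i + 3"
    by simp
  ultimately show ?thesis
    by (simp only: x_def)
qed

lemma parcs_Y_imp_three_arc:
  assumes "(u, v) \<in> parcs graph_Y"
  shows "three_arc u v"
proof -
  obtain p i where p: "pre_digraph.cycle (with_proj biggs_smith) p" "length p = 9" and "i < 9"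
    and uv: "{u, v} = {fst (p ! i), fst (p ! ((i + 3) mod 9))}"
    using assms by (auto simp: graph_Y_def)
  have "three_arc (fst (p ! i)) (fst (p ! ((i + 3) mod 9)))"
    using three_arc_of_9_cycle[OF p, of i] \<open>i < 9\<close> by simp
  with uv show ?thesis
    by (auto simp: doubleton_eq_iff dest: three_arc_sym)
qed

lemma bs_aut_cycle:
  assumes "bs_aut \<phi>" "pre_digraph.cycle (with_proj biggs_smith) p"
  shows "pre_digraph.cycle (with_proj biggs_smith) (map (map_prod \<phi> \<phi>) p)"
proof -
  obtain u where p: "set p \<subseteq> parcs biggs_smith" "pcas u p u" "distinct (map snd p)" "p \<noteq> []"
    using assms(2)
    by (auto simp: pre_digraph.cycle_def pre_digraph.awalk_def cas_with_proj_eq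
        awalk_verts_with_proj_eq pawalk_verts_conv)
  have "pcas (\<phi> v) (map (map_prod \<phi> \<phi>) q) (\<phi> w)" if "pcas v q w" for v q w
    using that by (induction q arbitrary: v) auto
  then have cas: "pcas (\<phi> u) (map (map_prod \<phi> \<phi>) p) (\<phi> u)"
    using p(2) by blast
  have "set (map (map_prod \<phi> \<phi>) p) \<subseteq> parcs biggs_smith"
    using p(1) assms(1) by (auto simp: bs_aut_def)
  moreover have "distinct (map snd (map (map_prod \<phi> \<phi>) p))"
  proof -
    have "inj \<phi>"
      using assms(1) by (simp add: bs_aut_def bij_is_inj)
    then have "distinct (map \<phi> (map snd p))"
      using p(3) by (simp only: distinct_map) (simp add: inj_on_subset[OF _ subset_UNIV])
    then show ?thesis by (simp add: comp_def)
  qed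
  ultimately show ?thesis
    using cas p(4)
    by (auto simp: pre_digraph.cycle_def pre_digraph.awalk_def cas_with_proj_eq
        awalk_verts_with_proj_eq pawalk_verts_conv biggs_smith_def intro!: exI[of _ "\<phi> u"])
qed

text \<open>The image of a 9-cycle under an automorphism is a 9-cycle, and vertices keep their
  positions on it.\<close>

lemma bs_aut_parcs_Y:
  assumes "bs_aut \<phi>" "(u, v) \<in> parcs graph_Y"
  shows "(\<phi> u, \<phi> v) \<in> parcs graph_Y"
proof -
  obtain p i where p: "pre_digraph.cycle (with_proj biggs_smith) p" "length p = 9" and "i < 9"
    and uv: "{u, v} = {fst (p ! i), fst (p ! ((i + 3) mod 9))}" and "u \<noteq> v"
    using assms(2) by (auto simp: graph_Y_def)
  let ?q = "map (map_prod \<phi> \<phi>) p"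
  have "{\<phi> u, \<phi> v} = {fst (?q ! i), fst (?q ! ((i + 3) mod 9))}"
    using arg_cong[OF uv, of "image \<phi>"] p(2) \<open>i < 9\<close> by simp
  with \<open>i < 9\<close> have "\<exists>i<9. {\<phi> u, \<phi> v} = {fst (?q ! i), fst (?q ! ((i + 3) mod 9))}"
    by blast
  moreover have "\<phi> u \<noteq> \<phi> v"
    using assms(1) \<open>u \<noteq> v\<close> by (simp add: bs_aut_def bij_is_inj inj_eq)
  moreover have "length ?q = 9"
    using p(2) by simp
  ultimately show ?thesis
    using bs_aut_cycle[OF assms(1) p(1)]
    unfolding graph_Y_def pair_pre_digraph.simps mem_Collect_eq prod.case
    by (intro conjI exI[of _ ?q])
qed

lemma bs_aut_isomorphism_Y:
  assumes "bs_aut \<phi>"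
  shows "is_isomorphism (with_proj graph_Y) (with_proj graph_Y)
    \<lparr>iso_verts = \<phi>, iso_arcs = map_prod \<phi> \<phi>, iso_head = snd, iso_tail = fst\<rparr>"
proof -
  interpret pair_graph graph_Y by (rule pair_graph_Y)
  have wf: "wf_digraph (with_proj graph_Y)" ..
  have bij: "bij \<phi>"
    using assms by (simp add: bs_aut_def)
  then have "inj (map_prod \<phi> \<phi>)"
    by (intro prod.inj_map bij_is_inj)
  then have inj: "inj_on (map_prod \<phi> \<phi>) (parcs graph_Y)"
    by (rule inj_on_subset) simp
  \<comment> \<open>An injective map of the finite arc set into itself is onto.\<close>
  have "map_prod \<phi> \<phi> ` parcs graph_Y = parcs graph_Y"
    using inj bs_aut_parcs_Y[OF assms] by (intro endo_inj_surj) auto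
  moreover have "\<phi> ` pverts graph_Y = pverts graph_Y"
    using bij by (simp add: graph_Y_def biggs_smith_def bij_is_surj)
  moreover have "inj_on \<phi> (pverts graph_Y)"
    using bij by (meson bij_is_inj inj_on_subset subset_UNIV)
  ultimately show ?thesis
    using wf inj
    by (simp add: is_isomorphism_def pre_digraph.digraph_isomorphism_def app_iso_def with_proj_def)
qed

section \<open>Extending isomorphisms between induced 4-cliques\<close>

lemma three_arc_in_induced_clique:
  assumes "induced_subgraph H (with_proj graph_Y)" "complete_digraph n H"
    "u \<in> verts H" "v \<in> verts H" "u \<noteq> v"
  shows "three_arc u v"
proof -
  have "tail H = fst" "head H = snd" "arcs H \<subseteq> parcs graph_Y"
    using assms(1) by (simp_all add: induced_subgraph_def subgraph_def compatible_def)
  moreover have "(u, v) \<in> arcs_ends H"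
    using assms(2-5) by (auto simp: complete_digraph_def)
  ultimately have "(u, v) \<in> parcs graph_Y"
    by (auto simp: arcs_ends_def arc_to_ends_def)
  then show ?thesis
    by (rule parcs_Y_imp_three_arc)
qed

theorem theorem6:
  shows "ultrahomogeneous (complete_digraph 4) (with_proj graph_Y)"
  unfolding ultrahomogeneous_def
proof (intro allI impI, elim conjE)
  fix H\<^sub>1 H\<^sub>2 :: "(bs_vertex, bs_vertex \<times> bs_vertex) pre_digraph"
    and f :: "(bs_vertex, bs_vertex \<times> bs_vertex, bs_vertex, bs_vertex \<times> bs_vertex) digraph_isomorphism"
  assume H: "induced_subgraph H\<^sub>1 (with_proj graph_Y)" "induced_subgraph H\<^sub>2 (with_proj graph_Y)"
    "complete_digraph 4 H\<^sub>1" "complete_digraph 4 H\<^sub>2" "is_isomorphism H\<^sub>1 H\<^sub>2 f"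
  let ?f = "iso_verts f"
  have iso: "pre_digraph.digraph_isomorphism H\<^sub>1 f" and H2: "H\<^sub>2 = app_iso f H\<^sub>1"
    using H(5) by (simp_all add: is_isomorphism_def)
  \<comment> \<open>The tail and head maps of \<open>H\<^sub>2\<close> are \<open>iso_tail f\<close>
    and \<open>iso_head f\<close> by construction, and the projections because it is a subgraph of
    \<open>graph_Y\<close>.\<close>
  have proj: "tail H\<^sub>1 = fst" "head H\<^sub>1 = snd" "iso_tail f = fst" "iso_head f = snd"
    using H(1,2) by (simp_all add: H2 induced_subgraph_def subgraph_def compatible_def)
  have inj: "inj_on ?f (verts H\<^sub>1)"
    using iso by (rule pre_digraph.digraph_isomorphism_inj_on_verts)
  have "card (verts H\<^sub>1) = 4" "finite (verts H\<^sub>1)"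
    using H(3) by (auto simp: complete_digraph_def)
  then obtain xs where "set xs = verts H\<^sub>1" "distinct xs" "length xs = 4"
    by (metis finite_distinct_list distinct_card)
  moreover from this(3) obtain a b c d where "xs = [a, b, c, d]"
    by (auto simp: eval_nat_numeral length_Suc_conv)
  ultimately have abcd: "verts H\<^sub>1 = {a, b, c, d}" "distinct [a, b, c, d]"
    by auto
  have "three_arc u v" if "u \<in> verts H\<^sub>1" "v \<in> verts H\<^sub>1" "u \<noteq> v" for u v
    using three_arc_in_induced_clique[OF H(1,3)] that .
  then obtain \<phi> where \<phi>: "bs_aut \<phi>" "map \<phi> [a, b, c, d] = [A_vert 0, A_vert 3, C_vert 4, C_vert 16]"
    using three_arc_clique_transitive[of a b c d] abcd by auto
  have "three_arc (?f u) (?f v)" if "u \<in> verts H\<^sub>1" "v \<in> verts H\<^sub>1" "u \<noteq> v" for u v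
    using that inj three_arc_in_induced_clique[OF H(2,4), of "?f u" "?f v"]
    by (simp add: H2 inj_on_eq_iff)
  then obtain \<psi> where \<psi>: "bs_aut \<psi>"
    "map \<psi> [?f a, ?f b, ?f c, ?f d] = [A_vert 0, A_vert 3, C_vert 4, C_vert 16]"
    using three_arc_clique_transitive[of "?f a" "?f b" "?f c" "?f d"] abcd by auto
  have "inv \<psi> (\<psi> u) = u" for u
    using \<psi>(1) by (simp add: bs_aut_def bij_is_inj)
  \<comment> \<open>On the four vertices, \<open>\<phi>\<close> and \<open>\<psi> \<circ> ?f\<close>
    give the same standard tuple.\<close>
  then have extends: "(inv \<psi> \<circ> \<phi>) u = ?f u" if "u \<in> verts H\<^sub>1" for u
    using that \<phi>(2) \<psi>(2) unfolding abcd(1) list.map list.inject comp_apply by (metis insertE empty_iff)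
  let ?g = "\<lparr>iso_verts = inv \<psi> \<circ> \<phi>, iso_arcs = map_prod (inv \<psi> \<circ> \<phi>) (inv \<psi> \<circ> \<phi>),
    iso_head = snd, iso_tail = fst\<rparr>"
  have "is_isomorphism (with_proj graph_Y) (with_proj graph_Y) ?g"
    using \<phi>(1) \<psi>(1) by (intro bs_aut_isomorphism_Y bs_aut_comp bs_aut_inv)
  \<comment> \<open>The arc map of \<open>f\<close> is a separate component, but arcs are pairs of
    their ends and \<open>f\<close> respects tails and heads, so its vertex map determines it on
    \<open>H\<^sub>1\<close>.\<close>
  moreover have "iso_arcs ?g e = iso_arcs f e" if "e \<in> arcs H\<^sub>1" for e
  proof -
    interpret H: wf_digraph H\<^sub>1
      using H(1) by (simp add: induced_subgraph_def subgraph_def)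
    have "fst e \<in> verts H\<^sub>1" "snd e \<in> verts H\<^sub>1"
      using H.tail_in_verts[OF that] H.head_in_verts[OF that] by (simp_all add: proj)
    moreover have "fst (iso_arcs f e) = ?f (fst e)" "snd (iso_arcs f e) = ?f (snd e)"
      using H.iso_verts_tail[OF iso that] H.iso_verts_head[OF iso that] by (simp_all add: proj)
    ultimately show ?thesis
      using extends by (simp add: prod_eq_iff)
  qed
  ultimately show "\<exists>g. is_isomorphism (with_proj graph_Y) (with_proj graph_Y) g \<and>
      (\<forall>v\<in>verts H\<^sub>1. iso_verts g v = iso_verts f v) \<and>
      (\<forall>a\<in>arcs H\<^sub>1. iso_arcs g a = iso_arcs f a)"
    using extends by (intro exI[of _ ?g]) simp
qed

end
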